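(* Let $(Y,S,Z,W)$ be a random vector, with $Y\in\mathbb{R}^{d_Y}$, $S\in\mathbb{R}^{d_S}$, $Z\in\mathbb{R}^{d_Z}$, $W\in\mathbb{R}^{d}$. If $W$ is conditionally independent of $S$ given $(Y,Z)$ and $W$ is conditionally independent of $Z$ given $Y$, then $W$ is conditionally independent of $S$ given $Y$.
   Context: All random vectors are defined on a common probability space. "$U$ is conditionally independent of $V$ given $Q$" means that $\mathbb{E}[g(U)h(V)\mid Q]=\mathbb{E}[g(U)\mid Q]\,\mathbb{E}[h(V)\mid Q]$ almost surely for all bounded measurable real functions $g,h$. *)

theory Defs
  imports "HOL-Probability.Probability"
begin

definition sigma_gen :: "'a measure \<Rightarrow> ('a \<Rightarrow> 'q::topological_space) \<Rightarrow> 'a measure" where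
  "sigma_gen M Q = vimage_algebra (space M) Q borel"

(* Conditioning on Q means conditioning on the sigma-algebra generated by Q.
   Meant for Borel measurable U, V, Q on a probability space M: real_cond_exp is
   constantly 0 if sigma_gen M Q is not a subalgebra of M. *)
definition cond_indep ::
  "'a measure \<Rightarrow> ('a \<Rightarrow> 'u::topological_space) \<Rightarrow> ('a \<Rightarrow> 'v::topological_space) \<Rightarrow>
   ('a \<Rightarrow> 'q::topological_space) \<Rightarrow> bool" where
  "cond_indep M U V Q \<longleftrightarrow>
    (\<forall>(g :: 'u \<Rightarrow> real) (h :: 'v \<Rightarrow> real).
      g \<in> borel_measurable borel \<longrightarrow> bounded (range g) \<longrightarrow>
      h \<in> borel_measurable borel \<longrightarrow> bounded (range h) \<longrightarrow>
      (AE \<omega> in M. real_cond_exp M (sigma_gen M Q) (\<lambda>\<omega>. g (U \<omega>) * h (V \<omega>)) \<omega> =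
         real_cond_exp M (sigma_gen M Q) (\<lambda>\<omega>. g (U \<omega>)) \<omega> *
         real_cond_exp M (sigma_gen M Q) (\<lambda>\<omega>. h (V \<omega>)) \<omega>))"

lemma subalgebra_sigma_gen:
  assumes "Q \<in> borel_measurable M"
  shows "subalgebra M (sigma_gen M Q)"
  using assms unfolding subalgebra_def sigma_gen_def
  by (auto simp: sets_vimage_algebra2 intro: measurable_sets)

end

theory Submission
  imports Defs
begin

text \<open>Since W is conditionally independent of Z given Y, conditioning g(W) on (Y, Z) gives the same
  result as conditioning it on Y; by a Dynkin argument this only has to be tested on events
  Y \<in> A, Z \<in> B. Hence, by the tower property,
  E[g(W) h(S) | Y] = E[E[g(W) | Y, Z] E[h(S) | Y, Z] | Y] = E[E[g(W) | Y] E[h(S) | Y, Z] | Y],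
  and the factor E[g(W) | Y] can be pulled out.\<close>

section \<open>Integrability and bounds for products and conditional expectations\<close>

lemma integrable_mult_AE_bounded:
  fixes f g :: "'a \<Rightarrow> real"
  assumes [measurable]: "f \<in> borel_measurable M" and g: "integrable M g"
    and f: "AE x in M. \<bar>f x\<bar> \<le> B"
  shows "integrable M (\<lambda>x. f x * g x)"
proof (rule Bochner_Integration.integrable_bound)
  show "integrable M (\<lambda>x. B * \<bar>g x\<bar>)"
    using g by simp
  show "(\<lambda>x. f x * g x) \<in> borel_measurable M"
    using g by measurable
  show "AE x in M. norm (f x * g x) \<le> norm (B * \<bar>g x\<bar>)"
    using f
  proof eventually_elim
    case (elim x)
    then have "\<bar>f x\<bar> * \<bar>g x\<bar> \<le> \<bar>B\<bar> * \<bar>g x\<bar>"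
      by (intro mult_right_mono) auto
    then show ?case
      by (simp add: abs_mult)
  qed
qed

text \<open>Monotonicity against the two constants \<open>B\<close> and \<open>- B\<close>. It keeps
  a conditioned test function bounded, so that multiplying by it preserves integrability.\<close>

lemma (in sigma_finite_subalgebra) real_cond_exp_abs_le:
  assumes "integrable M f" "AE x in M. \<bar>f x\<bar> \<le> B"
  shows "AE x in M. \<bar>real_cond_exp M F f x\<bar> \<le> B"
proof -
  have "AE x in M. real_cond_exp M F f x \<le> B"
    using assms by (intro real_cond_exp_le_c) auto
  moreover have "AE x in M. real_cond_exp M F f x \<ge> - B"
    using assms by (intro real_cond_exp_ge_c) auto
  ultimately show ?thesis
    by eventually_elim auto
qed

text \<open>The sets on which the two integrals agree form a Dynkin system, and \<open>G\<close> is
  intersection-stable, so the pi-lambda theorem applies. Equality over the whole space is assumed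
  separately because \<open>space M\<close> need not belong to \<open>G\<close>; it is what handles
  complements.\<close>

lemma set_integral_eq_sigma_sets:
  fixes f g :: "'a \<Rightarrow> real"
  assumes G: "Int_stable G" "G \<subseteq> sets M"
    and f: "integrable M f" and g: "integrable M g"
    and eq: "\<And>A. A \<in> G \<Longrightarrow> (\<integral>x\<in>A. f x \<partial>M) = (\<integral>x\<in>A. g x \<partial>M)"
    and eq_space: "(\<integral>x. f x \<partial>M) = (\<integral>x. g x \<partial>M)"
    and A: "A \<in> sigma_sets (space M) G"
  shows "(\<integral>x\<in>A. f x \<partial>M) = (\<integral>x\<in>A. g x \<partial>M)"
proof -
  have sub: "sigma_sets (space M) G \<subseteq> sets M"
    using G(2) by (rule sets.sigma_sets_subset)
  have int: "set_integrable M A k" if "A \<in> sets M" "integrable M k" for A and k :: "'a \<Rightarrow> real"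
    unfolding set_integrable_def using that by (rule integrable_mult_indicator)
  have G_Pow: "G \<subseteq> Pow (space M)"
    using G(2) sets.space_closed by blast
  from G(1) G_Pow A show ?thesis
  proof (induction rule: sigma_sets_induct_disjoint)
    case (basic A)
    then show ?case by (rule eq)
  next
    case empty
    show ?case by (simp add: set_lebesgue_integral_def)
  next
    case (compl A)
    have "A \<in> sets M"
      using compl sub by auto
    have split: "(\<integral>x\<in>space M - A. k x \<partial>M) = (\<integral>x. k x \<partial>M) - (\<integral>x\<in>A. k x \<partial>M)"
      if "integrable M k" for k :: "'a \<Rightarrow> real"
    proof -
      have "set_integrable M A k" "set_integrable M (space M - A) k"
        using that \<open>A \<in> sets M\<close> by (auto intro!: int)
      then have "(\<integral>x\<in>A \<union> (space M - A). k x \<partial>M) = (\<integral>x\<in>A. k x \<partial>M) + (\<integral>x\<in>space M - A. k x \<partial>M)"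
        by (intro set_integral_Un) auto
      moreover have "A \<union> (space M - A) = space M"
        using sets.sets_into_space[OF \<open>A \<in> sets M\<close>] by auto
      ultimately show ?thesis
        using set_integral_space[OF that] by simp
    qed
    show ?case
      by (simp only: split[OF f] split[OF g] eq_space compl)
  next
    case (union A)
    have "A i \<in> sets M" for i
      using union sub by auto
    then have "(\<integral>x\<in>(\<Union>i. A i). f x \<partial>M) = (\<Sum>i. \<integral>x\<in>A i. f x \<partial>M)"
      "(\<integral>x\<in>(\<Union>i. A i). g x \<partial>M) = (\<Sum>i. \<integral>x\<in>A i. g x \<partial>M)"
      using union(1) by (auto intro!: lebesgue_integral_countable_add int f g simp: disjoint_family_on_def)
    then show ?case
      using union by simp
  qed
qed

section \<open>Sigma-algebras generated by random variables and by pairs\<close>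

lemma space_sigma_gen [simp]: "space (sigma_gen M Q) = space M"
  by (simp add: sigma_gen_def)

lemma measurable_sigma_gen [measurable]: "Q \<in> borel_measurable (sigma_gen M Q)"
  unfolding sigma_gen_def by (rule measurable_vimage_algebra1) simp

lemma sets_sigma_gen_subset:
  assumes "space N = space M" "Q \<in> borel_measurable N"
  shows "sets (sigma_gen M Q) \<subseteq> sets N"
  using assms unfolding sigma_gen_def by (rule sets_image_in_sets)

lemma subalgebra_sigma_gen_Pair:
  fixes Q :: "'a \<Rightarrow> 'q::second_countable_topology"
    and V :: "'a \<Rightarrow> 'v::second_countable_topology"
  shows "subalgebra (sigma_gen M (\<lambda>x. (Q x, V x))) (sigma_gen M Q)"
proof -
  have "fst \<circ> (\<lambda>x. (Q x, V x)) \<in> borel_measurable (sigma_gen M (\<lambda>x. (Q x, V x)))"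
    by (rule measurable_comp[OF measurable_sigma_gen])
      (intro borel_measurable_continuous_onI continuous_intros)
  then show ?thesis
    unfolding subalgebra_def by (simp add: comp_def sets_sigma_gen_subset)
qed

text \<open>Both components, hence the pair, are measurable for the sigma-algebra generated by the
  rectangles, and \<open>sigma_gen\<close> is the smallest one making the pair measurable. Second
  countability lets measurability of the components yield Borel measurability of the pair.\<close>

lemma sets_sigma_gen_Pair_subset:
  fixes Q :: "'a \<Rightarrow> 'q::second_countable_topology"
    and V :: "'a \<Rightarrow> 'v::second_countable_topology"
  shows "sets (sigma_gen M (\<lambda>x. (Q x, V x))) \<subseteq>
    sigma_sets (space M) {Q -` A \<inter> V -` B \<inter> space M |A B. A \<in> sets borel \<and> B \<in> sets borel}"
    (is "_ \<subseteq> sigma_sets _ ?G")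
proof -
  let ?N = "sigma (space M) ?G"
  have G: "?G \<subseteq> Pow (space M)"
    by auto
  have gen: "Q -` A \<inter> V -` B \<inter> space M \<in> sets ?N" if "A \<in> sets borel" "B \<in> sets borel" for A B
    using that G by auto
  \<comment> \<open>A preimage under one component alone is the rectangle whose other side is
    \<open>UNIV\<close>.\<close>
  have "Q \<in> borel_measurable ?N"
    using gen[of _ UNIV] by (intro measurableI) (auto simp: space_measure_of[OF G])
  moreover have "V \<in> borel_measurable ?N"
    using gen[of UNIV] by (intro measurableI) (auto simp: space_measure_of[OF G])
  ultimately have "(\<lambda>x. (Q x, V x)) \<in> borel_measurable ?N"
    by (rule borel_measurable_Pair)
  then show ?thesis
    using sets_sigma_gen_subset[of ?N M "\<lambda>x. (Q x, V x)"] G by simp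
qed

section \<open>Conditioning on a pair under conditional independence\<close>

lemma (in prob_space) sigma_finite_subalgebra_sigma_gen:
  assumes "Q \<in> borel_measurable M"
  shows "sigma_finite_subalgebra M (sigma_gen M Q)"
  using subalgebra_sigma_gen[OF assms]
  by (intro finite_measure_subalgebra_is_sigma_finite finite_measure_subalgebra.intro
      finite_measure_subalgebra_axioms.intro) unfold_locales

lemma (in prob_space) integrable_bounded_comp:
  fixes g :: "'u::topological_space \<Rightarrow> real"
  assumes [measurable]: "U \<in> borel_measurable M" "g \<in> borel_measurable borel"
    and g: "bounded (range g)"
  shows "integrable M (\<lambda>x. g (U x))"
proof -
  obtain B where "\<And>u. \<bar>g u\<bar> \<le> B"
    using g by (auto simp: bounded_iff)
  then show ?thesis
    by (intro integrable_const_bound[where B = B]) auto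
qed

text \<open>Once \<open>Q\<close> is known, \<open>V\<close> carries no further information about
  \<open>U\<close>. The candidate \<open>?r\<close> is measurable for the larger sigma-algebra, so
  it suffices to compare integrals of \<open>?f\<close> and \<open>?r\<close> over its events;
  conditional independence gives this for rectangles.\<close>

lemma (in prob_space) real_cond_exp_cond_indep:
  fixes Q :: "'a \<Rightarrow> 'q::second_countable_topology"
    and V :: "'a \<Rightarrow> 'v::second_countable_topology"
    and U :: "'a \<Rightarrow> 'u::topological_space"
    and g :: "'u \<Rightarrow> real"
  assumes [measurable]: "U \<in> borel_measurable M" "V \<in> borel_measurable M" "Q \<in> borel_measurable M"
    and indep: "cond_indep M U V Q"
    and g [measurable]: "g \<in> borel_measurable borel" and g_bd: "bounded (range g)"
  shows "AE x in M. real_cond_exp M (sigma_gen M (\<lambda>x. (Q x, V x))) (\<lambda>x. g (U x)) x =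
    real_cond_exp M (sigma_gen M Q) (\<lambda>x. g (U x)) x"
proof -
  let ?F = "sigma_gen M Q" and ?H = "sigma_gen M (\<lambda>x. (Q x, V x))"
  let ?f = "\<lambda>x. g (U x)"
  let ?r = "real_cond_exp M ?F ?f"
  let ?G = "{Q -` A \<inter> V -` B \<inter> space M |A B. A \<in> sets borel \<and> B \<in> sets borel}"
  interpret F: sigma_finite_subalgebra M ?F
    by (rule sigma_finite_subalgebra_sigma_gen) measurable
  interpret H: sigma_finite_subalgebra M ?H
    by (rule sigma_finite_subalgebra_sigma_gen) measurable
  have f: "integrable M ?f"
    using g_bd by (intro integrable_bounded_comp) auto
  obtain B where B: "\<And>u. \<bar>g u\<bar> \<le> B"
    using g_bd by (auto simp: bounded_iff)
  have r: "AE x in M. \<bar>?r x\<bar> \<le> B"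
    using B by (intro F.real_cond_exp_abs_le f) auto
  have r_int: "integrable M ?r"
    using f by (rule F.real_cond_exp_int)
  have rectangle: "(\<integral>x\<in>E. ?f x \<partial>M) = (\<integral>x\<in>E. ?r x \<partial>M)" if "E \<in> ?G" for E
  proof -
    obtain A C where E: "E = Q -` A \<inter> V -` C \<inter> space M"
      and [measurable]: "A \<in> sets borel" "C \<in> sets borel"
      using \<open>E \<in> ?G\<close> by auto
    let ?a = "\<lambda>x. indicator A (Q x) :: real" and ?c = "\<lambda>x. indicator C (V x) :: real"
    let ?rc = "real_cond_exp M ?F ?c"
    \<comment> \<open>The rectangle is written as a product of two indicators because they are
      treated differently: \<open>?a\<close> is measurable for \<open>?F\<close>, while
      \<open>?c\<close> acts as the test function of \<open>V\<close>.\<close>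
    have split: "(\<integral>x\<in>E. k x \<partial>M) = (\<integral>x. ?a x * k x * ?c x \<partial>M)" for k :: "'a \<Rightarrow> real"
      unfolding set_lebesgue_integral_def E
      by (intro Bochner_Integration.integral_cong) (auto simp: indicator_def)
    have a [measurable]: "?a \<in> borel_measurable ?F"
      by measurable
    have fc: "integrable M (\<lambda>x. ?f x * ?c x)"
      using B by (intro integrable_mult_AE_bounded[where B = B] integrable_const_bound[where B = 1]) auto
    have "(\<integral>x. ?a x * ?f x * ?c x \<partial>M) = (\<integral>x. ?a x * (?f x * ?c x) \<partial>M)"
      by (simp add: mult.assoc)
    also have "\<dots> = (\<integral>x. ?a x * real_cond_exp M ?F (\<lambda>x. ?f x * ?c x) x \<partial>M)"
      by (intro F.real_cond_exp_intg(2)[symmetric] integrable_mult_AE_bounded[where B = 1] fc a) auto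
    also have "\<dots> = (\<integral>x. (?a x * ?r x) * ?rc x \<partial>M)"
    proof (rule integral_cong_AE)
      \<comment> \<open>The indicator of \<open>C\<close> is an admissible choice of
        \<open>h\<close> in \<open>cond_indep\<close>.\<close>
      have "bounded (range (indicator C :: 'v \<Rightarrow> real))"
        by (auto simp: bounded_iff indicator_def intro!: exI[of _ 1])
      then have "AE x in M. real_cond_exp M ?F (\<lambda>x. ?f x * ?c x) x = ?r x * ?rc x"
        using indep g_bd unfolding cond_indep_def by simp
      then show "AE x in M. ?a x * real_cond_exp M ?F (\<lambda>x. ?f x * ?c x) x = (?a x * ?r x) * ?rc x"
        by eventually_elim simp
    qed measurable
    \<comment> \<open>Since \<open>?a\<close> and \<open>?r\<close> are both measurable for
      \<open>?F\<close>, the conditioning on \<open>?c\<close> can be undone under the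
      integral.\<close>
    also have "\<dots> = (\<integral>x. (?a x * ?r x) * ?c x \<partial>M)"
    proof (rule F.real_cond_exp_intg(2))
      \<comment> \<open>The two indicators together form a factor bounded by 1, and
        \<open>?r\<close> is the integrable one.\<close>
      show "integrable M (\<lambda>x. (?a x * ?r x) * ?c x)"
        using integrable_mult_AE_bounded[of "\<lambda>x. ?a x * ?c x" M ?r 1] r_int
        by (simp add: ac_simps indicator_def)
    qed measurable
    finally show ?thesis
      by (simp add: split)
  qed
  show ?thesis
  proof (rule H.real_cond_exp_charact)
    show "?r \<in> borel_measurable ?H"
      using subalgebra_sigma_gen_Pair borel_measurable_cond_exp by (rule measurable_from_subalg)
    fix E assume "E \<in> sets ?H"
    then have E: "E \<in> sigma_sets (space M) ?G"
      using sets_sigma_gen_Pair_subset by blast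
    have "Int_stable ?G"
    proof (rule Int_stableI)
      fix D E assume "D \<in> ?G" "E \<in> ?G"
      then obtain A B A' B' where "D = Q -` A \<inter> V -` B \<inter> space M" "E = Q -` A' \<inter> V -` B' \<inter> space M"
        and [simp]: "A \<in> sets borel" "B \<in> sets borel" "A' \<in> sets borel" "B' \<in> sets borel"
        by auto
      then have "D \<inter> E = Q -` (A \<inter> A') \<inter> V -` (B \<inter> B') \<inter> space M"
        by auto
      moreover have "A \<inter> A' \<in> sets borel" "B \<inter> B' \<in> sets borel"
        by auto
      ultimately show "D \<inter> E \<in> ?G"
        by blast
    qed
    moreover have "?G \<subseteq> sets M"
    proof safe
      fix A B assume [measurable]: "A \<in> sets (borel :: 'q measure)" "B \<in> sets (borel :: 'v measure)"
      have "{x \<in> space M. Q x \<in> A \<and> V x \<in> B} \<in> sets M"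
        by measurable
      also have "{x \<in> space M. Q x \<in> A \<and> V x \<in> B} = Q -` A \<inter> V -` B \<inter> space M"
        by auto
      finally show "Q -` A \<inter> V -` B \<inter> space M \<in> sets M" .
    qed
    \<comment> \<open>Agreement over the whole space holds because conditioning preserves the
      expectation.\<close>
    ultimately show "(\<integral>x\<in>E. ?f x \<partial>M) = (\<integral>x\<in>E. ?r x \<partial>M)"
      using f r_int rectangle F.real_cond_exp_int(2)[OF f, symmetric] E
      by (rule set_integral_eq_sigma_sets)
  qed (fact f r_int)+
qed

text \<open>The contraction rule of graphoids, whose usual conclusion concerns the pair of
  \<open>Z\<close> and \<open>S\<close>, reduced to the component \<open>S\<close>. Second
  countability is imposed on \<open>Y\<close> and \<open>Z\<close> since they are joined into a
  pair; \<open>W\<close> and \<open>S\<close> enter only through bounded real functions.\<close>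

lemma (in prob_space) cond_indep_contraction:
  fixes Y :: "'a \<Rightarrow> 'y::second_countable_topology"
    and Z :: "'a \<Rightarrow> 'z::second_countable_topology"
    and S :: "'a \<Rightarrow> 's::topological_space"
    and W :: "'a \<Rightarrow> 'w::topological_space"
  assumes [measurable]: "Y \<in> borel_measurable M" "S \<in> borel_measurable M"
    "Z \<in> borel_measurable M" "W \<in> borel_measurable M"
    and WS: "cond_indep M W S (\<lambda>x. (Y x, Z x))" and WZ: "cond_indep M W Z Y"
  shows "cond_indep M W S Y"
  unfolding cond_indep_def
proof (intro allI impI)
  fix g :: "'w \<Rightarrow> real" and h :: "'s \<Rightarrow> real"
  assume g [measurable]: "g \<in> borel_measurable borel" and g_bd: "bounded (range g)"
    and h [measurable]: "h \<in> borel_measurable borel" and h_bd: "bounded (range h)"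
  let ?F = "sigma_gen M Y" and ?H = "sigma_gen M (\<lambda>x. (Y x, Z x))"
  let ?g = "\<lambda>x. g (W x)" and ?h = "\<lambda>x. h (S x)"
  interpret F: sigma_finite_subalgebra M ?F
    by (rule sigma_finite_subalgebra_sigma_gen) measurable
  interpret H: sigma_finite_subalgebra M ?H
    by (rule sigma_finite_subalgebra_sigma_gen) measurable
  have gint: "integrable M ?g"
    using g_bd by (intro integrable_bounded_comp) auto
  have hint: "integrable M ?h"
    using h_bd by (intro integrable_bounded_comp) auto
  obtain B where B: "\<And>u. \<bar>g u\<bar> \<le> B"
    using g_bd by (auto simp: bounded_iff)
  have gh: "integrable M (\<lambda>x. ?g x * ?h x)"
    using B hint by (intro integrable_mult_AE_bounded[where B = B]) auto
  have rg: "AE x in M. \<bar>real_cond_exp M ?F ?g x\<bar> \<le> B"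
    using B by (intro F.real_cond_exp_abs_le gint) auto
  \<comment> \<open>Pulling out a factor requires the whole product to be integrable. The bound on
    the conditional expectation is available only almost everywhere, which is enough here.\<close>
  have prod_int: "integrable M (\<lambda>x. real_cond_exp M ?F ?g x * real_cond_exp M ?H ?h x)"
    by (rule integrable_mult_AE_bounded[OF _ H.real_cond_exp_int(1)[OF hint] rg]) measurable
  have inner: "AE x in M. real_cond_exp M ?H (\<lambda>x. ?g x * ?h x) x =
      real_cond_exp M ?F ?g x * real_cond_exp M ?H ?h x"
  proof -
    have "AE x in M. real_cond_exp M ?H (\<lambda>x. ?g x * ?h x) x =
        real_cond_exp M ?H ?g x * real_cond_exp M ?H ?h x"
      using WS g g_bd h h_bd unfolding cond_indep_def by blast
    \<comment> \<open>This is where independence of \<open>W\<close> and \<open>Z\<close> given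
      \<open>Y\<close> enters: it makes the first factor measurable for \<open>?F\<close>.\<close>
    moreover have "AE x in M. real_cond_exp M ?H ?g x = real_cond_exp M ?F ?g x"
      using WZ g_bd by (intro real_cond_exp_cond_indep) auto
    ultimately show ?thesis
      by eventually_elim simp
  qed
  have sub: "subalgebra M ?H" "subalgebra ?H ?F"
    by (rule H.subalg, rule subalgebra_sigma_gen_Pair)
  have "AE x in M. real_cond_exp M ?F (real_cond_exp M ?H (\<lambda>x. ?g x * ?h x)) x =
      real_cond_exp M ?F (\<lambda>x. ?g x * ?h x) x"
    using sub gh by (rule F.real_cond_exp_nested_subalg)
  moreover have "AE x in M. real_cond_exp M ?F (real_cond_exp M ?H (\<lambda>x. ?g x * ?h x)) x =
      real_cond_exp M ?F (\<lambda>x. real_cond_exp M ?F ?g x * real_cond_exp M ?H ?h x) x"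
    using inner by (rule F.real_cond_exp_cong) measurable
  moreover have "AE x in M. real_cond_exp M ?F (\<lambda>x. real_cond_exp M ?F ?g x * real_cond_exp M ?H ?h x) x =
      real_cond_exp M ?F ?g x * real_cond_exp M ?F (real_cond_exp M ?H ?h) x"
    using prod_int by (intro F.real_cond_exp_mult) auto
  \<comment> \<open>A second use of the tower property removes the inner conditioning on
    \<open>Z\<close> from the remaining factor.\<close>
  moreover have "AE x in M. real_cond_exp M ?F (real_cond_exp M ?H ?h) x = real_cond_exp M ?F ?h x"
    using sub hint by (rule F.real_cond_exp_nested_subalg)
  ultimately show "AE x in M. real_cond_exp M ?F (\<lambda>x. ?g x * ?h x) x =
      real_cond_exp M ?F ?g x * real_cond_exp M ?F ?h x"
    by eventually_elim simp
qed

text \<open>Finite-dimensional real vector spaces are second countable, so the contraction rule for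
  general topological spaces specialises to them.\<close>

theorem lemma2:
  fixes M :: "'a measure"
    and Y :: "'a \<Rightarrow> real ^ 'dY"
    and S :: "'a \<Rightarrow> real ^ 'dS"
    and Z :: "'a \<Rightarrow> real ^ 'dZ"
    and W :: "'a \<Rightarrow> real ^ 'd"
  assumes "prob_space M"
    and "Y \<in> borel_measurable M"
    and "S \<in> borel_measurable M"
    and "Z \<in> borel_measurable M"
    and "W \<in> borel_measurable M"
    and "cond_indep M W S (\<lambda>\<omega>. (Y \<omega>, Z \<omega>))"
    and "cond_indep M W Z Y"
  shows "cond_indep M W S Y"
  using assms by (rule prob_space.cond_indep_contraction)

end
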